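(* No tensor $A\in\mathbb{R}^{2\times2\times2}$ with $\operatorname{rank}_{\otimes}(A)=3$ has an optimal rank-$2$ approximation with respect to the Frobenius norm; that is, for every such $A$ the infimum $\inf\{\|A-B\|_F : B\in\mathbb{R}^{2\times 2\times 2},\ \operatorname{rank}_{\otimes}(B)\le 2\}$ is not attained by any $B$ with $\operatorname{rank}_{\otimes}(B)\le 2$. In particular, no tensor of type $G_3$ has an optimal rank-$2$ approximation, and the tensors of type $G_3$ comprise a set that is open in $\mathbb{R}^{2\times2\times2}$ and therefore of positive volume.
   Context: $\mathbb{R}^{2\times2\times2}\cong\mathbb{R}^2\otimes\mathbb{R}^2\otimes\mathbb{R}^2$ is the space of real $2\times2\times2$ arrays; $\mathbf{x}\otimes\mathbf{y}\otimes\mathbf{z}$ is the array with entries $x_iy_jz_k$ (a decomposable tensor). The outer-product rank $\operatorname{rank}_{\otimes}(A)$ is the least $r\ge 0$ such that $A$ is a sum of $r$ decomposable tensors. The Frobenius norm is $\|A\|_F=(\sum_{i,j,k}a_{ijk}^2)^{1/2}$. Matrices act by multilinear multiplication: $(L,M,N)\cdot A$ has entries $\sum_{i,j,k}\lambda_{pi}\mu_{qj}\nu_{rk}a_{ijk}$ where $L=[\lambda_{pi}]$, $M=[\mu_{qj}]$, $N=[\nu_{rk}]$. Let $$G_3=\mathbf{e}_1\otimes\mathbf{e}_1\otimes\mathbf{e}_1+\mathbf{e}_1\otimes\mathbf{e}_2\otimes\mathbf{e}_2-\mathbf{e}_2\otimes\mathbf{e}_1\otimes\mathbf{e}_2+\mathbf{e}_2\otimes\mathbf{e}_2\otimes\mathbf{e}_1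 ,$$ with $\mathbf{e}_1,\mathbf{e}_2$ the standard basis of $\mathbb{R}^2$. A tensor $A\in\mathbb{R}^{2\times2\times2}$ is of type $G_3$ if $A=(L,M,N)\cdot G_3$ for some $L,M,N\in\mathrm{GL}_2(\mathbb{R})$. Volume means Lebesgue measure. *)

theory Defs
  imports "HOL-Analysis.Analysis"
begin

text \<open>
  The array with entries \<open>a\<^sub>i\<^sub>j\<^sub>k\<close> is the vector of vectors of vectors \<open>A\<close> with
  \<open>A $ i $ j $ k = a\<^sub>i\<^sub>j\<^sub>k\<close>. Its topology and Lebesgue measure are those of the
  eight-dimensional Euclidean space \<^typ>\<open>real^2^2^2\<close>.
\<close>

type_synonym tensor = "real^2^2^2"

definition outer :: "real^2 \<Rightarrow> real^2 \<Rightarrow> real^2 \<Rightarrow> tensor" where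
  "outer x y z = (\<chi> i j k. x $ i * y $ j * z $ k)"

definition sum_of_decomposables :: "nat \<Rightarrow> tensor \<Rightarrow> bool" where
  "sum_of_decomposables r A \<longleftrightarrow>
     (\<exists>x y z :: nat \<Rightarrow> real^2. A = (\<Sum>m<r. outer (x m) (y m) (z m)))"

definition tensor_rank :: "tensor \<Rightarrow> nat" where
  "tensor_rank A = (LEAST r. sum_of_decomposables r A)"

definition frobenius_norm :: "tensor \<Rightarrow> real" where
  "frobenius_norm A = sqrt (\<Sum>i\<in>UNIV. \<Sum>j\<in>UNIV. \<Sum>k\<in>UNIV. (A $ i $ j $ k)\<^sup>2)"

definition multilinear_mult ::
    "real^2^2 \<Rightarrow> real^2^2 \<Rightarrow> real^2^2 \<Rightarrow> tensor \<Rightarrow> tensor" where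
  "multilinear_mult L M N A =
     (\<chi> p q r. \<Sum>i\<in>UNIV. \<Sum>j\<in>UNIV. \<Sum>k\<in>UNIV.
        L $ p $ i * M $ q $ j * N $ r $ k * A $ i $ j $ k)"

text \<open>The numeral type \<open>2\<close> has the two distinct elements \<open>1\<close> and \<open>2\<close> (the latter equals \<open>0\<close>).\<close>

abbreviation e1 :: "real^2" where "e1 \<equiv> axis 1 1"
abbreviation e2 :: "real^2" where "e2 \<equiv> axis 2 1"

definition G3 :: tensor where
  "G3 = outer e1 e1 e1 + outer e1 e2 e2 - outer e2 e1 e2 + outer e2 e2 e1"

definition type_G3 :: "tensor \<Rightarrow> bool" where
  "type_G3 A \<longleftrightarrow>
     (\<exists>L M N. invertible L \<and> invertible M \<and> invertible N \<and> A = multilinear_mult L M N G3)"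

definition optimal_rank_approx :: "nat \<Rightarrow> tensor \<Rightarrow> tensor \<Rightarrow> bool" where
  "optimal_rank_approx r A B \<longleftrightarrow>
     tensor_rank B \<le> r \<and>
     frobenius_norm (A - B) = (INF C\<in>{C. tensor_rank C \<le> r}. frobenius_norm (A - C))"

text \<open>
  The least element in the definition of the rank exists, and the infimum in the definition
  of an optimal approximation is that of a nonempty set of reals that is bounded below, so
  neither takes an unspecified value.
\<close>

lemma sum_of_decomposables_8: "sum_of_decomposables 8 A"
proof -
  define b where "b m = (if m then 1 else 2 :: 2)" for m
  define x where "x m = (axis (b (m < 4)) (A $ b (m < 4) $ b (m mod 4 < 2) $ b (even m)) :: real^2)"
    for m :: nat
  define y where "y m = (axis (b (m mod 4 < 2)) 1 :: real^2)" for m :: nat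
  define z where "z m = (axis (b (even m)) 1 :: real^2)" for m :: nat
  have eight: "(\<Sum>m<8. f m) = f 0 + f 1 + f 2 + f 3 + f 4 + f 5 + f 6 + f 7"
    for f :: "nat \<Rightarrow> real"
    by (simp add: lessThan_nat_numeral lessThan_Suc algebra_simps)
  have "A = (\<Sum>m<8. outer (x m) (y m) (z m))"
    unfolding vec_eq_iff forall_2 sum_component eight
    by (simp add: outer_def axis_def x_def y_def z_def b_def)
  then show ?thesis
    unfolding sum_of_decomposables_def by blast
qed

lemma sum_of_decomposables_tensor_rank: "sum_of_decomposables (tensor_rank A) A"
  unfolding tensor_rank_def by (rule LeastI[of "\<lambda>r. sum_of_decomposables r A", OF sum_of_decomposables_8])

lemma tensor_rank_zero: "tensor_rank 0 = 0"
  unfolding tensor_rank_def by (rule Least_eq_0) (simp add: sum_of_decomposables_def)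

lemma bdd_below_frobenius: "bdd_below ((\<lambda>C. frobenius_norm (A - C)) ` S)"
  by (rule bdd_belowI[of _ 0]) (auto simp: frobenius_norm_def intro!: sum_nonneg)

lemma frobenius_norm_eq_norm: "frobenius_norm A = norm A"
  by (simp add: frobenius_norm_def norm_vec_def L2_set_def sum_nonneg)

end

theory Submission
  imports Defs
begin

text \<open>
  Let \<open>B = x\<^sub>1 \<otimes> y\<^sub>1 \<otimes> z\<^sub>1 + x\<^sub>2 \<otimes> y\<^sub>2 \<otimes> z\<^sub>2\<close> be a nearest tensor of rank at most two to \<open>A\<close>.
  Whenever a line through \<open>B\<close> consists of tensors of rank at most two, the residual \<open>A - B\<close> is
  orthogonal to its direction. Such directions are \<open>x \<otimes> y\<^sub>1 \<otimes> z\<^sub>1\<close>, \<open>x\<^sub>1 \<otimes> y \<otimes> z\<^sub>1\<close> and so on, for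
  every decomposition of \<open>B\<close>; they always span the whole space, so \<open>A = B\<close>. Hence no tensor of
  rank greater than two has a nearest tensor of rank at most two. The tensors of type \<open>G\<^sub>3\<close> are
  those of negative hyperdeterminant, while rank at most two forces a nonnegative one.
\<close>

section \<open>Trilinear maps and sums of two of their values\<close>

definition trilinear ::
    "('a::real_vector \<Rightarrow> 'a \<Rightarrow> 'a \<Rightarrow> 'b::real_vector) \<Rightarrow> bool" where
  "trilinear f \<longleftrightarrow> (\<forall>y z. linear (\<lambda>x. f x y z)) \<and> (\<forall>x z. linear (\<lambda>y. f x y z)) \<and>
     (\<forall>x y. linear (\<lambda>z. f x y z))"

text \<open>Working with a general \<open>f\<close> instead of \<open>outer\<close> pays off here: a
  result about the first slot transfers to the other two by exchanging slots.\<close>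

lemma trilinear_swap:
  assumes "trilinear f"
  shows "trilinear (\<lambda>x y z. f y x z)" "trilinear (\<lambda>x y z. f z y x)"
  using assms by (auto simp: trilinear_def)

lemma trilinear_simps:
  assumes "trilinear f"
  shows "f (x + x') y z = f x y z + f x' y z" "f x (y + y') z = f x y z + f x y' z"
    "f x y (z + z') = f x y z + f x y z'"
    "f (x - x') y z = f x y z - f x' y z" "f x (y - y') z = f x y z - f x y' z"
    "f x y (z - z') = f x y z - f x y z'"
    "f (r *\<^sub>R x) y z = r *\<^sub>R f x y z" "f x (r *\<^sub>R y) z = r *\<^sub>R f x y z"
    "f x y (r *\<^sub>R z) = r *\<^sub>R f x y z"
    "f 0 y z = 0" "f x 0 z = 0" "f x y 0 = 0"
proof -
  have *: "linear (\<lambda>x. f x y z)" "linear (\<lambda>y. f x y z)" "linear (\<lambda>z. f x y z)" for x y z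
    using assms by (auto simp: trilinear_def)
  note lin = linear_add linear_diff linear_scale linear_0
  show "f (x + x') y z = f x y z + f x' y z" "f (x - x') y z = f x y z - f x' y z"
    "f (r *\<^sub>R x) y z = r *\<^sub>R f x y z" "f 0 y z = 0"
    using lin[OF *(1)] by blast+
  show "f x (y + y') z = f x y z + f x y' z" "f x (y - y') z = f x y z - f x y' z"
    "f x (r *\<^sub>R y) z = r *\<^sub>R f x y z" "f x 0 z = 0"
    using lin[OF *(2)] by blast+
  show "f x y (z + z') = f x y z + f x y z'" "f x y (z - z') = f x y z - f x y z'"
    "f x y (r *\<^sub>R z) = r *\<^sub>R f x y z" "f x y 0 = 0"
    using lin[OF *(3)] by blast+
qed

definition two_term_sums :: "('a \<Rightarrow> 'a \<Rightarrow> 'a \<Rightarrow> 'b::plus) \<Rightarrow> 'b set" where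
  "two_term_sums f = {f x y z + f x' y' z' |x y z x' y' z'. True}"

lemma two_term_sums_swap:
  "two_term_sums (\<lambda>x y z. f y x z) = two_term_sums f"
  "two_term_sums (\<lambda>x y z. f z y x) = two_term_sums f"
  unfolding two_term_sums_def by blast+

section \<open>Orthogonality of the residual at a nearest point\<close>

definition nearest :: "'b::real_normed_vector set \<Rightarrow> 'b \<Rightarrow> 'b \<Rightarrow> bool" where
  "nearest S A B \<longleftrightarrow> B \<in> S \<and> (\<forall>C\<in>S. norm (A - B) \<le> norm (A - C))"

lemma residual_orthogonal_line:
  fixes A B T :: "'b::real_inner"
  assumes "nearest S A B" and "\<And>t. B + t *\<^sub>R T \<in> S"
  shows "inner (A - B) T = 0"
proof (rule ccontr)
  define R where "R = A - B"
  assume "inner (A - B) T \<noteq> 0"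
  then have p: "inner R T \<noteq> 0" and q: "inner T T > 0"
    by (auto simp: R_def)
  \<comment> \<open>The minimiser of the quadratic \<open>norm (R - t *\<^sub>R T)\<close>
    squared.\<close>
  define t where "t = inner R T / inner T T"
  have "norm R \<le> norm (R - t *\<^sub>R T)"
    using assms unfolding nearest_def R_def by (metis diff_diff_eq)
  then have "inner R R \<le> inner (R - t *\<^sub>R T) (R - t *\<^sub>R T)"
    by (simp add: norm_le)
  also have "\<dots> = inner R R - 2 * t * inner R T + t * t * inner T T"
    by (simp add: algebra_simps inner_commute)
  also have "\<dots> = inner R R - (inner R T)\<^sup>2 / inner T T"
    using q by (simp add: t_def field_simps power2_eq_square)
  finally show False
    using p q by (simp add: divide_le_0_iff)
qed

text \<open>Changing \<open>x1\<close> alone is an affine motion of \<open>B\<close> that keeps two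
  terms.\<close>

lemma residual_orthogonal_first:
  fixes f :: "'a::real_vector \<Rightarrow> 'a \<Rightarrow> 'a \<Rightarrow> 'b::real_inner"
  assumes f: "trilinear f" and near: "nearest (two_term_sums f) A B"
    and B: "B = f x1 y1 z1 + f x2 y2 z2"
  shows "inner (A - B) (f x y1 z1) = 0"
proof (rule residual_orthogonal_line[OF near])
  fix t
  have "B + t *\<^sub>R f x y1 z1 = f (x1 + t *\<^sub>R x) y1 z1 + f x2 y2 z2"
    by (simp add: B trilinear_simps[OF f])
  then show "B + t *\<^sub>R f x y1 z1 \<in> two_term_sums f"
    unfolding two_term_sums_def by blast
qed

lemma residual_orthogonal_tangent:
  fixes f :: "'a::real_vector \<Rightarrow> 'a \<Rightarrow> 'a \<Rightarrow> 'b::real_inner"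
  assumes f: "trilinear f" and near: "nearest (two_term_sums f) A B"
    and B: "B = f x1 y1 z1 + f x2 y2 z2"
  shows "inner (A - B) (f x y1 z1) = 0" "inner (A - B) (f x1 y z1) = 0"
    "inner (A - B) (f x1 y1 z) = 0" "inner (A - B) (f x y2 z2) = 0"
    "inner (A - B) (f x2 y z2) = 0" "inner (A - B) (f x2 y2 z) = 0"
proof -
  have B': "B = f x2 y2 z2 + f x1 y1 z1"
    using B by (simp add: add.commute)
  note n1 = near[folded two_term_sums_swap(1)[of f]]
  note n2 = near[folded two_term_sums_swap(2)[of f]]
  show "inner (A - B) (f x y1 z1) = 0" "inner (A - B) (f x y2 z2) = 0"
    using residual_orthogonal_first[OF f near] B B' by blast+
  show "inner (A - B) (f x1 y z1) = 0" "inner (A - B) (f x2 y z2) = 0"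
    using residual_orthogonal_first[OF trilinear_swap(1)[OF f] n1] B B' by blast+
  show "inner (A - B) (f x1 y1 z) = 0" "inner (A - B) (f x2 y2 z) = 0"
    using residual_orthogonal_first[OF trilinear_swap(2)[OF f] n2] B B' by blast+
qed

text \<open>One term suffices for such a point, so the second is free to be any decomposable
  direction.\<close>

lemma residual_orthogonal_decomposable:
  fixes f :: "'a::real_vector \<Rightarrow> 'a \<Rightarrow> 'a \<Rightarrow> 'b::real_inner"
  assumes f: "trilinear f" and near: "nearest (two_term_sums f) A (f u v w)"
  shows "inner (A - f u v w) (f x y z) = 0"
proof (rule residual_orthogonal_line[OF near])
  fix t
  have "f u v w + t *\<^sub>R f x y z = f u v w + f (t *\<^sub>R x) y z"
    by (simp add: trilinear_simps[OF f])
  then show "f u v w + t *\<^sub>R f x y z \<in> two_term_sums f"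
    unfolding two_term_sums_def by blast
qed

lemma pair_spans_or_parallel:
  fixes x1 x2 :: "real^2"
  obtains (spans) "\<And>x. \<exists>a b. x = a *\<^sub>R x1 + b *\<^sub>R x2"
  | (parallel) u a b where "x1 = a *\<^sub>R u" "x2 = b *\<^sub>R u"
proof (cases "x1 $ 1 * x2 $ 2 - x1 $ 2 * x2 $ 1 = 0")
  case True
  show thesis
  proof (cases "x1 = 0")
    case True
    then show thesis
      by (intro parallel[of 0 x2 1]) auto
  next
    case False
    then consider "x1 $ 1 \<noteq> 0" | "x1 $ 2 \<noteq> 0"
      by (auto simp: vec_eq_iff forall_2)
    then have "x2 = (x2 $ 1 / x1 $ 1) *\<^sub>R x1 \<or> x2 = (x2 $ 2 / x1 $ 2) *\<^sub>R x1"
      using True by cases (auto simp: vec_eq_iff forall_2 field_simps)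
    then show thesis
      by (metis parallel scaleR_one)
  qed
next
  case False
  define d where "d = x1 $ 1 * x2 $ 2 - x1 $ 2 * x2 $ 1"
  \<comment> \<open>Cramer's rule.\<close>
  have "x = ((x $ 1 * x2 $ 2 - x $ 2 * x2 $ 1) / d) *\<^sub>R x1 +
      ((x1 $ 1 * x $ 2 - x1 $ 2 * x $ 1) / d) *\<^sub>R x2" for x
    using False unfolding d_def
    by (simp add: vec_eq_iff forall_2 divide_simps) (simp add: algebra_simps)
  then show thesis
    using spans by blast
qed

text \<open>For \<open>outer\<close>, \<open>B\<close> is \<open>u\<close> times a matrix. If either
  remaining pair is parallel, that matrix has rank at most one and \<open>B\<close> is decomposable;
  otherwise both pairs are bases.\<close>

lemma residual_orthogonal_common_factor:
  fixes f :: "real^2 \<Rightarrow> real^2 \<Rightarrow> real^2 \<Rightarrow> 'b::real_inner"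
  assumes f: "trilinear f" and near: "nearest (two_term_sums f) A B"
    and B: "B = f u y1 z1 + f u y2 z2"
  shows "inner (A - B) (f x y z) = 0"
proof (cases rule: pair_spans_or_parallel[of y1 y2])
  case (parallel v a b)
  then have "B = f u v (a *\<^sub>R z1 + b *\<^sub>R z2)"
    by (simp add: B trilinear_simps[OF f])
  then show ?thesis
    using residual_orthogonal_decomposable[OF f] near by blast
next
  case y: spans
  show ?thesis
  proof (cases rule: pair_spans_or_parallel[of z1 z2])
    case (parallel v a b)
    then have "B = f u (a *\<^sub>R y1 + b *\<^sub>R y2) v"
      by (simp add: B trilinear_simps[OF f])
    then show ?thesis
      using residual_orthogonal_decomposable[OF f] near by blast
  next
    case z: spans
    text \<open>The decomposition of \<open>B\<close> is not unique here; the other ones supply the mixed directions.\<close>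
    have B1: "B = f u (y1 + y2) z1 + f u y2 (z2 - z1)"
      and B2: "B = f u y1 (z1 + z2) + f u (y2 - y1) z2"
      by (simp_all add: B trilinear_simps[OF f])
    have "inner (A - B) (f x y1 z1) = 0" "inner (A - B) (f x y2 z2) = 0"
      using residual_orthogonal_tangent(1,4)[OF f near B] by blast+
    \<comment> \<open>The first term of \<open>B1\<close> gives the direction
      \<open>f x (y1 + y2) z1\<close>; the part with \<open>y1\<close> is already known to be
      orthogonal.\<close>
    moreover have "inner (A - B) (f x y2 z1) = 0"
      using residual_orthogonal_tangent(1)[OF f near B1, of x] calculation
      by (simp add: trilinear_simps[OF f] inner_add_right)
    moreover have "inner (A - B) (f x y1 z2) = 0"
      using residual_orthogonal_tangent(1)[OF f near B2, of x] calculation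
      by (simp add: trilinear_simps[OF f] inner_add_right)
    moreover obtain a b c d where "y = a *\<^sub>R y1 + b *\<^sub>R y2" "z = c *\<^sub>R z1 + d *\<^sub>R z2"
      using y z by meson
    ultimately show ?thesis
      by (simp add: trilinear_simps[OF f] inner_add_right)
  qed
qed

lemma residual_orthogonal:
  fixes f :: "real^2 \<Rightarrow> real^2 \<Rightarrow> real^2 \<Rightarrow> 'b::real_inner"
  assumes f: "trilinear f" and near: "nearest (two_term_sums f) A B"
  shows "inner (A - B) (f x y z) = 0"
proof -
  obtain x1 y1 z1 x2 y2 z2 where B: "B = f x1 y1 z1 + f x2 y2 z2"
    using near unfolding nearest_def two_term_sums_def by blast
  show ?thesis
  proof (cases rule: pair_spans_or_parallel[of x1 x2])
    case (parallel u a b)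
    then have "B = f u (a *\<^sub>R y1) z1 + f u (b *\<^sub>R y2) z2"
      by (simp add: B trilinear_simps[OF f])
    then show ?thesis
      using residual_orthogonal_common_factor[OF f near] by blast
  next
    case xs: spans
    show ?thesis
    proof (cases rule: pair_spans_or_parallel[of y1 y2])
      case (parallel u a b)
      then have "B = f (a *\<^sub>R x1) u z1 + f (b *\<^sub>R x2) u z2"
        by (simp add: B trilinear_simps[OF f])
      then show ?thesis
        using residual_orthogonal_common_factor[OF trilinear_swap(1)[OF f]
            near[folded two_term_sums_swap(1)[of f]]] by blast
    next
      case ys: spans
      show ?thesis
      proof (cases rule: pair_spans_or_parallel[of z1 z2])
        case (parallel u a b)
        then have "B = f (a *\<^sub>R x1) y1 u + f (b *\<^sub>R x2) y2 u"
          by (simp add: B trilinear_simps[OF f])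
        then show ?thesis
          using residual_orthogonal_common_factor[OF trilinear_swap(2)[OF f]
              near[folded two_term_sums_swap(2)[of f]]] by blast
      next
        case zs: spans
        \<comment> \<open>After expansion, each product takes its three factors from two terms of
          \<open>B\<close>, so at least two come from the same term: it is a tangent
          direction.\<close>
        obtain a b c d e g where "x = a *\<^sub>R x1 + b *\<^sub>R x2" "y = c *\<^sub>R y1 + d *\<^sub>R y2"
          "z = e *\<^sub>R z1 + g *\<^sub>R z2"
          using xs ys zs by meson
        then show ?thesis
          by (simp add: trilinear_simps[OF f] inner_add_right
              residual_orthogonal_tangent[OF f near B])
      qed
    qed
  qed
qed

section \<open>Tensors of rank at most two and their nearest points\<close>

lemma trilinear_outer: "trilinear outer"
  unfolding trilinear_def
  by (intro conjI allI linearI) (simp_all add: outer_def vec_eq_iff algebra_simps)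

lemma tensor_rank_le_2_iff: "tensor_rank A \<le> 2 \<longleftrightarrow> A \<in> two_term_sums outer"
proof
  assume le: "tensor_rank A \<le> 2"
  obtain x y z where A: "A = (\<Sum>m<tensor_rank A. outer (x m) (y m) (z m))"
    using sum_of_decomposables_tensor_rank[of A] unfolding sum_of_decomposables_def by blast
  \<comment> \<open>Padding by zero turns a shorter sum into one with exactly two terms.\<close>
  define x' where "x' m = (if m < tensor_rank A then x m else 0)" for m
  have "A = (\<Sum>m<tensor_rank A. outer (x' m) (y m) (z m))"
    by (subst A) (simp add: x'_def)
  also have "\<dots> = (\<Sum>m<2. outer (x' m) (y m) (z m))"
    by (rule sum.mono_neutral_left)
      (use le in \<open>auto simp: x'_def trilinear_simps[OF trilinear_outer]\<close>)
  finally have "A = outer (x' 0) (y 0) (z 0) + outer (x' 1) (y 1) (z 1)"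
    by (simp add: numeral_2_eq_2)
  then show "A \<in> two_term_sums outer"
    unfolding two_term_sums_def by blast
next
  assume "A \<in> two_term_sums outer"
  then obtain x1 y1 z1 x2 y2 z2 where A: "A = outer x1 y1 z1 + outer x2 y2 z2"
    unfolding two_term_sums_def by blast
  have "A = (\<Sum>m<2. outer (if m = 0 then x1 else x2) (if m = 0 then y1 else y2)
      (if m = (0::nat) then z1 else z2))"
    by (simp add: A numeral_2_eq_2)
  then have "sum_of_decomposables 2 A"
    unfolding sum_of_decomposables_def
    by (intro exI[of _ "\<lambda>m. if m = 0 then x1 else x2"] exI[of _ "\<lambda>m. if m = 0 then y1 else y2"]
        exI[of _ "\<lambda>m. if m = 0 then z1 else z2"])
  then show "tensor_rank A \<le> 2"
    unfolding tensor_rank_def by (rule Least_le)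
qed

lemma optimal_rank_2_approx_nearest:
  assumes "optimal_rank_approx 2 A B"
  shows "nearest (two_term_sums outer) A B"
proof -
  have "frobenius_norm (A - B) \<le> frobenius_norm (A - C)" if "tensor_rank C \<le> 2" for C
    using assms that unfolding optimal_rank_approx_def
    by (auto intro: cINF_lower[OF bdd_below_frobenius])
  then show ?thesis
    using assms unfolding nearest_def optimal_rank_approx_def
    by (simp add: tensor_rank_le_2_iff frobenius_norm_eq_norm)
qed

text \<open>The standard basis tensors are decomposable, so a residual orthogonal to all
  decomposable tensors has zero entries.\<close>

lemma inner_outer_axis:
  "inner A (outer (axis i 1) (axis j 1) (axis k 1)) = A $ i $ j $ k"
  using exhaust_2[of i] exhaust_2[of j] exhaust_2[of k]
  by (auto simp: inner_vec_def outer_def axis_def sum_2)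

lemma no_optimal_rank_2_approx:
  assumes "\<not> tensor_rank A \<le> 2"
  shows "\<not> optimal_rank_approx 2 A B"
proof
  assume opt: "optimal_rank_approx 2 A B"
  have "(A - B) $ i $ j $ k = 0" for i j k
    using residual_orthogonal[OF trilinear_outer optimal_rank_2_approx_nearest[OF opt]]
    by (metis inner_outer_axis)
  then have "A = B"
    by (simp add: vec_eq_iff)
  then show False
    using assms opt by (simp add: optimal_rank_approx_def)
qed

section \<open>The hyperdeterminant and type \<open>G3\<close>\<close>

text \<open>The coefficient of \<open>s * t\<close> in \<open>det (s X + t Y)\<close>.\<close>

definition polar_det :: "real^2^2 \<Rightarrow> real^2^2 \<Rightarrow> real" where
  "polar_det X Y = X $ 1 $ 1 * Y $ 2 $ 2 + X $ 2 $ 2 * Y $ 1 $ 1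
     - X $ 1 $ 2 * Y $ 2 $ 1 - X $ 2 $ 1 * Y $ 1 $ 2"

text \<open>The discriminant of the binary quadratic form \<open>det (s X + t Y)\<close>.\<close>
definition pencil_disc :: "real^2^2 \<Rightarrow> real^2^2 \<Rightarrow> real" where
  "pencil_disc X Y = (polar_det X Y)\<^sup>2 - 4 * det X * det Y"

text \<open>Cayley's hyperdeterminant, written through the two slices in the first index.\<close>

definition hyperdet :: "tensor \<Rightarrow> real" where
  "hyperdet A = pencil_disc (A $ 1) (A $ 2)"

text \<open>A linear substitution in \<open>(s, t)\<close> scales the discriminant of a binary
  quadratic form by the square of its determinant.\<close>

lemma pencil_disc_combination:
  "pencil_disc (a *\<^sub>R X + b *\<^sub>R Y) (c *\<^sub>R X + d *\<^sub>R Y) = (a * d - b * c)\<^sup>2 * pencil_disc X Y"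
  by (simp add: pencil_disc_def polar_det_def det_2) algebra

text \<open>Both slices are combinations of \<open>P\<close> and \<open>P'\<close>. Since
  \<open>P\<close> is singular, the discriminant of this pair is a square.\<close>

lemma hyperdet_nonneg:
  assumes "tensor_rank A \<le> 2"
  shows "hyperdet A \<ge> 0"
proof -
  obtain x y z x' y' z' where A: "A = outer x y z + outer x' y' z'"
    using assms unfolding tensor_rank_le_2_iff two_term_sums_def by blast
  define P where "P = (\<chi> j k. y $ j * z $ k)"
  define P' where "P' = (\<chi> j k. y' $ j * z' $ k)"
  have "det P = 0"
    by (simp add: P_def det_2)
  then have "pencil_disc P P' \<ge> 0"
    by (simp add: pencil_disc_def)
  moreover have "A $ i = x $ i *\<^sub>R P + x' $ i *\<^sub>R P'" for i
    by (simp add: A outer_def P_def P'_def vec_eq_iff)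
  ultimately show ?thesis
    by (simp add: hyperdet_def pencil_disc_combination)
qed

text \<open>The second slice of \<open>G3\<close>, a quarter turn; the first slice is the
  identity.\<close>

abbreviation J :: "real^2^2" where "J \<equiv> vector [vector [0, - 1], vector [1, 0]]"

lemma multilinear_mult_G3:
  "multilinear_mult L M N G3 $ p =
     L $ p $ 1 *\<^sub>R (M ** transpose N) + L $ p $ 2 *\<^sub>R (M ** J ** transpose N)"
  by (simp add: multilinear_mult_def G3_def outer_def axis_def vec_eq_iff sum_2 forall_2
      matrix_matrix_mult_def transpose_def algebra_simps)

lemma type_G3_imp_hyperdet_neg:
  assumes "type_G3 A"
  shows "hyperdet A < 0"
proof -
  obtain L M N where inv: "invertible L" "invertible M" "invertible N"
    and A: "A = multilinear_mult L M N G3"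
    using assms unfolding type_G3_def by blast
  define X Y where "X = M ** transpose N" and "Y = M ** J ** transpose N"
  \<comment> \<open>It equals \<open>det M * det N\<close> times the trace of
    \<open>J\<close>.\<close>
  have "polar_det X Y = 0"
    by (simp add: X_def Y_def polar_det_def matrix_matrix_mult_def transpose_def sum_2) algebra
  moreover have "det X = det M * det N" "det Y = det M * det N"
    by (simp_all add: X_def Y_def det_mul) (simp add: det_2)
  ultimately have "pencil_disc X Y = - (2 * det M * det N)\<^sup>2"
    by (simp add: pencil_disc_def power2_eq_square)
  moreover have "hyperdet A = (det L)\<^sup>2 * pencil_disc X Y"
    by (simp add: hyperdet_def A multilinear_mult_G3 pencil_disc_combination det_2[of L]
        flip: X_def Y_def)
  ultimately have "hyperdet A = - (2 * det L * det M * det N)\<^sup>2"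
    by (simp add: power_mult_distrib)
  then show ?thesis
    using inv by (simp add: invertible_det_nz)
qed

lemma simultaneous_factorization:
  assumes det: "det X = det Y" "det X \<noteq> 0" and polar: "polar_det X Y = 0"
  obtains M N where "invertible M" "invertible N" "X = M ** transpose N"
    "Y = M ** J ** transpose N"
proof -
  obtain a b c d where X: "X $ 1 $ 1 = a" "X $ 1 $ 2 = b" "X $ 2 $ 1 = c" "X $ 2 $ 2 = d"
    by blast
  obtain e f g h where Y: "Y $ 1 $ 1 = e" "Y $ 1 $ 2 = f" "Y $ 2 $ 1 = g" "Y $ 2 $ 2 = h"
    by blast
  define D where "D = a * d - b * c"
  have D: "D \<noteq> 0" "D = e * h - f * g"
    and p: "a * h + d * e - b * g - c * f = 0"
    using assms by (simp_all add: D_def det_2 polar_det_def X Y)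
  text \<open>
    \<open>K = Y X\<^sup>-\<^sup>1\<close> has trace 0 and determinant 1, so it is conjugate to \<open>J\<close> by the matrix with
    columns \<open>e\<^sub>1\<close> and \<open>K e\<^sub>1 = (r, s)\<close>.
  \<close>
  define r s where "r = (d * e - c * f) / D" and "s = (d * g - c * h) / D"
  \<comment> \<open>The equation \<open>det K = 1\<close> cleared of denominators, using trace 0.
    Its positive left side forces \<open>s \<noteq> 0\<close>, so \<open>e1\<close> and
    \<open>K e1\<close> are independent.\<close>
  have key: "(d * e - c * f)\<^sup>2 + D\<^sup>2 = (b * e - a * f) * (d * g - c * h)"
    using D(2) p unfolding D_def by algebra
  moreover have "D\<^sup>2 > 0"
    using D by simp
  ultimately have "d * g - c * h \<noteq> 0"
    by (metis add_nonneg_pos less_irrefl mult_zero_right zero_le_power2)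
  then have s: "s \<noteq> 0"
    using D by (simp add: s_def)
  define M :: "real^2^2" where "M = vector [vector [1, r], vector [0, s]]"
  \<comment> \<open>Chosen so that \<open>transpose N\<close> is the inverse of \<open>M\<close>
    times \<open>X\<close>.\<close>
  define N :: "real^2^2" where
    "N = vector [vector [a - r * c / s, c / s], vector [b - r * d / s, d / s]]"
  have XMN: "X = M ** transpose N"
    using s by (simp add: vec_eq_iff forall_2 X M_def N_def matrix_matrix_mult_def transpose_def
        sum_2)
  define q where "q = (a * f - b * e) / D"
  have "q * s = - (r * r + 1)"
  proof -
    have "q * D = a * f - b * e" "r * D = d * e - c * f" "s * D = d * g - c * h"
      using D(1) by (simp_all add: q_def r_def s_def)
    then have "(q * s + (r * r + 1)) * D\<^sup>2 = 0"
      using key by algebra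
    then show ?thesis
      using D(1) by simp
  qed
  then have q: "q = - (r * r + 1) / s"
    using s by (simp add: field_simps)
  \<comment> \<open>With the next fact, this is \<open>Y = K X\<close> entry by entry, where
    \<open>K\<close> has rows \<open>(r, q)\<close> and \<open>(s, -r)\<close>.\<close>
  have "r * a + q * c = e" "r * b + q * d = f"
    using D(1) by (simp_all add: r_def q_def field_simps) (simp_all add: D_def algebra_simps)
  moreover have "s * a - r * c = g" "s * b - r * d = h"
    using D(1) by (simp_all add: r_def s_def field_simps) (use p D_def in algebra)+
  ultimately have YMN: "Y = M ** J ** transpose N"
    using s by (simp add: vec_eq_iff forall_2 Y M_def N_def matrix_matrix_mult_def transpose_def
        sum_2 q algebra_simps add_divide_distrib diff_divide_distrib)
  have "det M \<noteq> 0"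
    using s by (simp add: M_def det_2)
  moreover have "det N \<noteq> 0"
    using det(2) by (auto simp: XMN det_mul)
  ultimately show thesis
    using that XMN YMN by (simp add: invertible_det_nz)
qed

lemma hyperdet_neg_imp_type_G3:
  assumes "hyperdet A < 0"
  shows "type_G3 A"
proof -
  define X Y where "X = A $ 1" and "Y = A $ 2"
  \<comment> \<open>The complex roots of \<open>det (Y - t X)\<close> are \<open>\<alpha>\<close>
    plus or minus \<open>i\<close> times \<open>\<beta>\<close>; they are not real because the
    discriminant is negative.\<close>
  define \<alpha> where "\<alpha> = polar_det X Y / (2 * det X)"
  define \<beta> where "\<beta> = sqrt (- hyperdet A) / (2 * det X)"
  have disc: "hyperdet A = (polar_det X Y)\<^sup>2 - 4 * det X * det Y"
    by (simp add: hyperdet_def pencil_disc_def X_def Y_def)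
  \<comment> \<open>Otherwise the hyperdeterminant would be a square.\<close>
  then have nz: "det X \<noteq> 0"
    using assms by (metis diff_zero mult_zero_left mult_zero_right not_less zero_le_power2)
  have \<beta>: "\<beta> \<noteq> 0" "\<beta>\<^sup>2 = - hyperdet A / (2 * det X)\<^sup>2"
    using assms nz by (simp_all add: \<beta>_def power_divide)
  text \<open>Normalised so that \<open>det (s X + t Z) = (s\<^sup>2 + t\<^sup>2) det X\<close>.\<close>
  define Z where "Z = (1 / \<beta>) *\<^sub>R (Y - \<alpha> *\<^sub>R X)"
  have "polar_det X Z = (polar_det X Y - 2 * \<alpha> * det X) / \<beta>"
    by (simp add: Z_def polar_det_def det_2 algebra_simps diff_divide_distrib add_divide_distrib)
  then have "polar_det X Z = 0"
    using nz by (simp add: \<alpha>_def)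
  moreover have "det Z = (det Y - \<alpha> * polar_det X Y + \<alpha>\<^sup>2 * det X) / \<beta>\<^sup>2"
    using \<beta>(1) by (simp add: Z_def polar_det_def det_2 field_simps power2_eq_square)
  moreover have "det Y - \<alpha> * polar_det X Y + \<alpha>\<^sup>2 * det X = \<beta>\<^sup>2 * det X"
    using nz unfolding \<beta>(2) by (simp add: \<alpha>_def disc field_simps power2_eq_square)
  ultimately have "polar_det X Z = 0" "det X = det Z"
    using \<beta>(1) by simp_all
  then obtain M N where MN: "invertible M" "invertible N" "X = M ** transpose N"
    "Z = M ** J ** transpose N"
    using simultaneous_factorization[of X Z] nz by metis
  \<comment> \<open>Its rows are the coordinates of the slices \<open>X\<close> and \<open>Y\<close>
    with respect to \<open>X\<close> and \<open>Z\<close>.\<close>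
  define L :: "real^2^2" where "L = vector [vector [1, 0], vector [\<alpha>, \<beta>]]"
  have "Y = \<alpha> *\<^sub>R X + \<beta> *\<^sub>R Z"
    using \<beta>(1) by (simp add: Z_def)
  then have "A $ p = multilinear_mult L M N G3 $ p" for p
    using exhaust_2[of p]
    by (auto simp: multilinear_mult_G3 L_def X_def Y_def simp flip: MN(3,4))
  moreover have "invertible L"
    using \<beta>(1) by (simp add: invertible_det_nz L_def det_2)
  ultimately show ?thesis
    using MN unfolding type_G3_def by (metis vec_eq_iff)
qed

lemma type_G3_iff_hyperdet_neg: "type_G3 A \<longleftrightarrow> hyperdet A < 0"
  using type_G3_imp_hyperdet_neg hyperdet_neg_imp_type_G3 by blast

section \<open>Openness and positive volume\<close>

text \<open>The hyperdeterminant is a polynomial in the entries, hence continuous.\<close>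

lemma open_type_G3: "open {A. type_G3 A}"
  unfolding type_G3_iff_hyperdet_neg hyperdet_def pencil_disc_def polar_det_def det_2
  by (intro open_Collect_less continuous_intros)

lemma type_G3_G3: "type_G3 G3"
  by (simp add: type_G3_iff_hyperdet_neg hyperdet_def pencil_disc_def polar_det_def det_2
      G3_def outer_def axis_def)

lemma emeasure_lebesgue_open_pos:
  fixes S :: "'a::euclidean_space set"
  assumes "open S" "S \<noteq> {}"
  shows "emeasure lebesgue S > 0"
proof -
  have "emeasure lebesgue S \<noteq> 0"
    using open_not_negligible[OF assms] assms(1) negligible_iff_emeasure0[of S] by auto
  then show ?thesis
    by (simp add: zero_less_iff_neq_zero)
qed

theorem theorem8p1:
  "(\<forall>A :: real^2^2^2. tensor_rank A = 3 \<longrightarrow> \<not> (\<exists>B. optimal_rank_approx 2 A B)) \<and>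
   (\<forall>A :: real^2^2^2. type_G3 A \<longrightarrow> \<not> (\<exists>B. optimal_rank_approx 2 A B)) \<and>
   open {A :: real^2^2^2. type_G3 A} \<and>
   emeasure lebesgue {A :: real^2^2^2. type_G3 A} > 0"
proof (intro conjI allI impI)
  show "\<not> (\<exists>B. optimal_rank_approx 2 A B)" if "tensor_rank A = 3" for A
    using no_optimal_rank_2_approx that by simp
  show "\<not> (\<exists>B. optimal_rank_approx 2 A B)" if "type_G3 A" for A
    using no_optimal_rank_2_approx hyperdet_nonneg type_G3_imp_hyperdet_neg[OF that]
    by (meson not_less)
  show "open {A. type_G3 A}"
    by (rule open_type_G3)
  show "emeasure lebesgue {A. type_G3 A} > 0"
    by (rule emeasure_lebesgue_open_pos[OF open_type_G3]) (use type_G3_G3 in blast)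
qed

end
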